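(* Let $(N,(A_i)_{i\in N},(u_i)_{i\in N})$ be a finite strategic game with player set $N=\{1,\dots,n\}$, with noncooperative payoff region $S_{\mathrm{nc}}\subset\mathbb{R}^n$ and cooperative payoff region $S_{\mathrm{co}}\subset\mathbb{R}^n$. Then a hyperplane $H$ in $\mathbb{R}^n$ is a supporting hyperplane to $S_{\mathrm{nc}}$ if and only if it is a supporting hyperplane to $S_{\mathrm{co}}$.
   Context: A finite strategic game $(N,(A_i)_{i\in N},(u_i)_{i\in N})$ consists of a player set $N=\{1,\dots,n\}$, for each $i\in N$ a nonempty finite set $A_i$ of pure strategies, and payoff functions $u_i\colon\prod_{j\in N}A_j\to\mathbb{R}$; put $u=(u_1,\dots,u_n)\colon\prod_{j\in N}A_j\to\mathbb{R}^n$. For a nonempty finite set $X$, $\Delta(X)$ is the set of probability distributions on $X$. For a correlated strategy $\varphi\in\Delta(\prod_{i\in N}A_i)$ set $u(\varphi)=\sum_{a\in\prod_{i\in N}A_i}\varphi(a)\,u(a)$. For a mixed-strategy profile $\sigma=(\sigma_1,\dots,\sigma_n)\in\prod_{i\in N}\Delta(A_i)$ set $u(\sigma)=\sum_{a\in\prod_{i\in N}A_i}\big(\prod_{i\in N}\sigma_i(a_i)\big)u(a)$. The payoff regions are $S_{\mathrm{nc}}=u(\prod_{i\in N}\Delta(A_i))$ (noncooperative) and $S_{\mathrm{co}}=u(\Delta(\prod_{i\in N}A_i))$ (cooperative). A hyperplane in $\mathbb{R}^n$ is a set $H=\{x\in\mathbb{R}^n\mid c\cdot x=\alpha\}$ with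 $c\in\mathbb{R}^n\setminus\{0\}$, $\alpha\in\mathbb{R}$; the closed half-spaces it determines are $H^-=\{x\mid c\cdot x\le\alpha\}$ and $H^+=\{x\mid c\cdot x\ge\alpha\}$. For a nonempty closed set $S\subseteq\mathbb{R}^n$, a hyperplane $H$ is a supporting hyperplane to $S$ if $S\cap H\ne\varnothing$ and $S$ is contained in one of the two closed half-spaces determined by $H$. *)

theory Defs
  imports "HOL-Analysis.Analysis" "HOL-Probability.Probability"
begin

section \<open>Finite strategic games\<close>

text \<open>
  Players are the elements of a finite type \<open>'n\<close>, so that payoff vectors live in \<open>real ^ 'n\<close>.
  All strategy sets are carved out of one ambient type \<open>'a\<close>; this is no loss of generality,
  since finitely many finite sets can always be embedded in a common type. Pure-strategy
  profiles are the elements of \<open>PiE UNIV A\<close>. Values of \<open>u i\<close> outside that set are never used.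
\<close>

definition finite_strategic_game :: "('n::finite \<Rightarrow> 'a set) \<Rightarrow> bool" where
  "finite_strategic_game A \<longleftrightarrow> (\<forall>i. finite (A i) \<and> A i \<noteq> {})"

definition distributions_on :: "'b set \<Rightarrow> 'b pmf set" where
  "distributions_on X = {p. set_pmf p \<subseteq> X}"

definition payoff_vector :: "('n::finite \<Rightarrow> ('n \<Rightarrow> 'a) \<Rightarrow> real) \<Rightarrow> ('n \<Rightarrow> 'a) \<Rightarrow> real ^ 'n" where
  "payoff_vector u a = (\<chi> i. u i a)"

definition correlated_payoff ::
  "('n::finite \<Rightarrow> 'a set) \<Rightarrow> ('n \<Rightarrow> ('n \<Rightarrow> 'a) \<Rightarrow> real) \<Rightarrow> ('n \<Rightarrow> 'a) pmf \<Rightarrow> real ^ 'n" where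
  "correlated_payoff A u \<phi> = (\<Sum>a\<in>PiE UNIV A. pmf \<phi> a *\<^sub>R payoff_vector u a)"

definition mixed_payoff ::
  "('n::finite \<Rightarrow> 'a set) \<Rightarrow> ('n \<Rightarrow> ('n \<Rightarrow> 'a) \<Rightarrow> real) \<Rightarrow> ('n \<Rightarrow> 'a pmf) \<Rightarrow> real ^ 'n" where
  "mixed_payoff A u \<sigma> =
     (\<Sum>a\<in>PiE UNIV A. (\<Prod>i\<in>UNIV. pmf (\<sigma> i) (a i)) *\<^sub>R payoff_vector u a)"

definition noncooperative_region ::
  "('n::finite \<Rightarrow> 'a set) \<Rightarrow> ('n \<Rightarrow> ('n \<Rightarrow> 'a) \<Rightarrow> real) \<Rightarrow> (real ^ 'n) set" where
  "noncooperative_region A u = mixed_payoff A u ` PiE UNIV (\<lambda>i. distributions_on (A i))"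

definition cooperative_region ::
  "('n::finite \<Rightarrow> 'a set) \<Rightarrow> ('n \<Rightarrow> ('n \<Rightarrow> 'a) \<Rightarrow> real) \<Rightarrow> (real ^ 'n) set" where
  "cooperative_region A u = correlated_payoff A u ` distributions_on (PiE UNIV A)"

section \<open>Supporting hyperplanes\<close>

definition hyperplane :: "(real ^ 'n) set \<Rightarrow> bool" where
  "hyperplane H \<longleftrightarrow> (\<exists>c \<alpha>. c \<noteq> 0 \<and> H = {x. c \<bullet> x = \<alpha>})"

text \<open>
  A hyperplane determines its equation only up to a nonzero factor, which at most swaps the
  two half-spaces; hence it does not matter which equation witnesses the existential.
  The notion is meant for nonempty closed \<open>S\<close>. For a finite game both payoff regions are such
  sets, being continuous images of nonempty compact sets.
\<close>

definition supporting_hyperplane :: "(real ^ 'n) set \<Rightarrow> (real ^ 'n) set \<Rightarrow> bool" where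
  "supporting_hyperplane H S \<longleftrightarrow>
     S \<inter> H \<noteq> {} \<and>
     (\<exists>c \<alpha>. c \<noteq> 0 \<and> H = {x. c \<bullet> x = \<alpha>} \<and>
            (S \<subseteq> {x. c \<bullet> x \<le> \<alpha>} \<or> S \<subseteq> {x. c \<bullet> x \<ge> \<alpha>}))"

end

theory Submission
  imports Defs
begin

text \<open>
  Both payoff regions lie between the finite set of pure payoff vectors and its convex hull.
  Closed half-spaces are convex, so such a set lies in one exactly when the pure payoff vectors do.
  If it then meets the bounding hyperplane, some pure payoff vector lies on that hyperplane,
  since otherwise the whole convex hull would lie in the open half-space, which is convex as well.
\<close>

text \<open>Negating both \<open>c\<close> and \<alpha> keeps the hyperplane and swaps its closed
  half-spaces, so only one orientation has to be treated from here on.\<close>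

lemma supporting_hyperplane_iff_le:
  "supporting_hyperplane H S \<longleftrightarrow>
     S \<inter> H \<noteq> {} \<and> (\<exists>c \<alpha>. c \<noteq> 0 \<and> H = {x. c \<bullet> x = \<alpha>} \<and> S \<subseteq> {x. c \<bullet> x \<le> \<alpha>})"
proof -
  have "\<exists>d \<beta>. d \<noteq> 0 \<and> {x. c \<bullet> x = \<alpha>} = {x. d \<bullet> x = \<beta>} \<and> S \<subseteq> {x. d \<bullet> x \<le> \<beta>}"
    if "c \<noteq> 0" "S \<subseteq> {x. c \<bullet> x \<ge> \<alpha>}" for c \<alpha>
    using that by (intro exI[of _ "- c"] exI[of _ "- \<alpha>"]) auto
  then show ?thesis
    unfolding supporting_hyperplane_def by metis
qed

lemma supporting_hyperplane_between_hull:
  assumes "P \<subseteq> S" and "S \<subseteq> convex hull P"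
  shows "supporting_hyperplane H S \<longleftrightarrow> supporting_hyperplane H P"
proof -
  have le: "S \<subseteq> {x. c \<bullet> x \<le> \<alpha>} \<longleftrightarrow> P \<subseteq> {x. c \<bullet> x \<le> \<alpha>}" for c \<alpha>
    using assms hull_minimal[of P "{x. c \<bullet> x \<le> \<alpha>}" convex] convex_halfspace_le by blast
  have meet: "S \<inter> {x. c \<bullet> x = \<alpha>} \<noteq> {} \<longleftrightarrow> P \<inter> {x. c \<bullet> x = \<alpha>} \<noteq> {}"
    if P: "P \<subseteq> {x. c \<bullet> x \<le> \<alpha>}" for c \<alpha>
  proof (rule iffI, rule ccontr)
    assume S: "S \<inter> {x. c \<bullet> x = \<alpha>} \<noteq> {}" and "\<not> P \<inter> {x. c \<bullet> x = \<alpha>} \<noteq> {}"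
    with P have "P \<subseteq> {x. c \<bullet> x < \<alpha>}"
      by (auto simp: less_le)
    then have "convex hull P \<subseteq> {x. c \<bullet> x < \<alpha>}"
      by (intro hull_minimal convex_halfspace_lt)
    with assms(2) S show False by auto
  qed (use assms(1) in auto)
  show ?thesis
    \<comment> \<open>The same \<open>c\<close> and \<alpha> serve both sides: \<open>le\<close>
      transfers the containment, and the containment of \<open>P\<close> is what allows
      \<open>meet\<close> to be applied.\<close>
    unfolding supporting_hyperplane_iff_le using le meet by metis
qed

text \<open>The point mass at \<open>a\<close> is a correlated strategy whose payoff sum keeps only
  the term of \<open>a\<close>.\<close>

lemma pure_payoff_mem_cooperative_region:
  assumes "finite_strategic_game A" and "a \<in> PiE UNIV A"
  shows "payoff_vector u a \<in> cooperative_region A u"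
proof -
  have fin: "finite (PiE UNIV A)"
    using assms(1) by (auto simp: finite_strategic_game_def intro!: finite_PiE)
  have "correlated_payoff A u (return_pmf a) =
      (\<Sum>b\<in>PiE UNIV A. if b = a then payoff_vector u b else 0)"
    unfolding correlated_payoff_def by (intro sum.cong) (auto simp: indicator_def)
  also have "\<dots> = payoff_vector u a"
    using fin assms(2) by (simp add: sum.delta)
  finally show ?thesis
    using assms(2) unfolding cooperative_region_def distributions_on_def
    by (intro image_eqI[of _ _ "return_pmf a"]) auto
qed

lemma pure_payoff_mem_noncooperative_region:
  assumes "finite_strategic_game A" and "a \<in> PiE UNIV A"
  shows "payoff_vector u a \<in> noncooperative_region A u"
proof -
  let ?\<sigma> = "\<lambda>i. return_pmf (a i)"
  have fin: "finite (PiE UNIV A)"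
    using assms(1) by (auto simp: finite_strategic_game_def intro!: finite_PiE)
  \<comment> \<open>Each factor is 1 or 0 according to whether \<open>b\<close> and \<open>a\<close>
    agree at \<open>i\<close>, so a single disagreement makes the product vanish.\<close>
  have "(\<Prod>i\<in>UNIV. pmf (?\<sigma> i) (b i)) = (if b = a then 1 else 0)" for b
    by (cases "b = a") (auto simp: indicator_def fun_eq_iff, metis)
  then have "mixed_payoff A u ?\<sigma> = (\<Sum>b\<in>PiE UNIV A. if b = a then payoff_vector u b else 0)"
    unfolding mixed_payoff_def by (intro sum.cong) auto
  also have "\<dots> = payoff_vector u a"
    using fin assms(2) by (simp add: sum.delta)
  finally show ?thesis
    using assms(2) unfolding noncooperative_region_def distributions_on_def
    by (intro image_eqI[of _ _ ?\<sigma>]) auto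
qed

lemma cooperative_region_subset_hull:
  assumes "finite_strategic_game A"
  shows "cooperative_region A u \<subseteq> convex hull (payoff_vector u ` PiE UNIV A)"
proof -
  have fin: "finite (PiE UNIV A)"
    using assms by (auto simp: finite_strategic_game_def intro!: finite_PiE)
  have "correlated_payoff A u \<phi> \<in> convex hull (payoff_vector u ` PiE UNIV A)"
    if "set_pmf \<phi> \<subseteq> PiE UNIV A" for \<phi>
    \<comment> \<open>The probabilities serve as convex weights; they sum to 1 over the pure
      profiles because these contain the support of \<open>\<phi>\<close>.\<close>
    unfolding correlated_payoff_def using fin that
    by (intro convex_sum) (auto simp: sum_pmf_eq_1 intro: hull_inc)
  then show ?thesis
    by (auto simp: cooperative_region_def distributions_on_def)
qed

lemma noncooperative_region_subset_hull:
  assumes "finite_strategic_game A"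
  shows "noncooperative_region A u \<subseteq> convex hull (payoff_vector u ` PiE UNIV A)"
proof -
  have finA: "finite (A i)" for i
    using assms by (simp add: finite_strategic_game_def)
  have fin: "finite (PiE UNIV A)"
    using finA by (auto intro!: finite_PiE)
  have "mixed_payoff A u \<sigma> \<in> convex hull (payoff_vector u ` PiE UNIV A)"
    if \<sigma>: "\<And>i. set_pmf (\<sigma> i) \<subseteq> A i" for \<sigma>
  proof -
    \<comment> \<open>By distributivity, the total weight of the profiles factors into one sum per
      player. Each such sum is 1, so the product probabilities are again convex weights.\<close>
    have "(\<Sum>a\<in>PiE UNIV A. \<Prod>i\<in>UNIV. pmf (\<sigma> i) (a i)) = (\<Prod>i\<in>UNIV. \<Sum>s\<in>A i. pmf (\<sigma> i) s)"
      using finA by (intro prod_sum_PiE[symmetric]) auto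
    also have "\<dots> = 1"
      using finA \<sigma> by (intro prod.neutral) (simp add: sum_pmf_eq_1)
    finally show ?thesis
      unfolding mixed_payoff_def using fin
      by (intro convex_sum) (auto intro: hull_inc prod_nonneg)
  qed
  then show ?thesis
    by (auto simp: noncooperative_region_def distributions_on_def PiE_iff)
qed

theorem theorem3p8:
  fixes A :: "'n::finite \<Rightarrow> 'a set"
    and u :: "'n \<Rightarrow> ('n \<Rightarrow> 'a) \<Rightarrow> real"
    and H :: "(real ^ 'n) set"
  assumes "finite_strategic_game A"
    and "hyperplane H"
  shows "supporting_hyperplane H (noncooperative_region A u) \<longleftrightarrow>
         supporting_hyperplane H (cooperative_region A u)"
proof -
  \<comment> \<open>The two regions are never compared directly: each has the same supporting
    hyperplanes as \<open>?P\<close>.\<close>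
  let ?P = "payoff_vector u ` PiE UNIV A"
  have "supporting_hyperplane H (noncooperative_region A u) \<longleftrightarrow> supporting_hyperplane H ?P"
    using assms(1) pure_payoff_mem_noncooperative_region noncooperative_region_subset_hull
    by (intro supporting_hyperplane_between_hull) blast+
  also have "\<dots> \<longleftrightarrow> supporting_hyperplane H (cooperative_region A u)"
    using assms(1) pure_payoff_mem_cooperative_region cooperative_region_subset_hull
    by (intro supporting_hyperplane_between_hull[symmetric]) blast+
  finally show ?thesis .
qed

end
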